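(* Let $\{\varphi_1,\ldots,\varphi_n\}$ be a system of contracting similitudes of $\mathbb{R}^2$ with rotation angles $\alpha_1,\ldots,\alpha_n$, satisfying the open convex set condition, and suppose that all the angles $\alpha_1,\ldots,\alpha_n$ are commensurable with $\pi$. Let $K$ be the compact invariant self-similar set of the system. Then the convex hull $\tilde K$ of $K$ is a convex finite polygon (that is, its set of extreme points is finite).
   Context: Identify $\mathbb{R}^2$ with $\mathbb{C}$. The contracting similitudes are $\varphi_i(z)=q_i e^{i\alpha_i}(z-z_i)+z_i$ (where the $i$ in $e^{i\alpha_i}$ is the imaginary unit), with $0<q_i<1$ and rotation angle $\alpha_i\in[0,2\pi]$. The invariant set $K$ is the unique non-empty compact set with $K=\bigcup_{i=1}^n\varphi_i(K)$. An angle $\alpha$ is commensurable with $\pi$ if $\alpha/\pi\in\mathbb{Q}$. Degenerate polygons (a segment or a point) are allowed. Open convex set condition (OCSC): there is a non-empty open convex set $O\subset\mathbb{R}^2$ such that $\bigcup_{i}\varphi_i(O)\subset O$ and $\varphi_i(O)\cap\varphi_j(O)=\emptyset$ whenever $i\neq j$. *)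

theory Defs
  imports "HOL-Analysis.Analysis"
begin

definition similitude :: "real \<Rightarrow> real \<Rightarrow> complex \<Rightarrow> complex \<Rightarrow> complex" where
  "similitude q a c z = complex_of_real q * exp (\<i> * complex_of_real a) * (z - c) + c"

definition commensurable_with_pi :: "real \<Rightarrow> bool" where
  "commensurable_with_pi a \<longleftrightarrow> a / pi \<in> \<rat>"

text \<open>
  A system is a family of maps indexed by \<open>{1..n}\<close>; disjointness below is required for distinct
  indices, even if the two maps coincide. The set \<open>U\<close> need not be bounded, and the inclusion
  is not required to be proper.
\<close>

definition open_convex_set_condition :: "nat \<Rightarrow> (nat \<Rightarrow> complex \<Rightarrow> complex) \<Rightarrow> bool" where
  "open_convex_set_condition n \<phi> \<longleftrightarrow>
     (\<exists>U. U \<noteq> {} \<and> open U \<and> convex U \<and>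
          (\<Union>i\<in>{1..n}. \<phi> i ` U) \<subseteq> U \<and>
          (\<forall>i\<in>{1..n}. \<forall>j\<in>{1..n}. i \<noteq> j \<longrightarrow> \<phi> i ` U \<inter> \<phi> j ` U = {}))"

text \<open>
  For contractions there is exactly one such \<open>K\<close> if \<open>n \<ge> 1\<close>, and none if \<open>n = 0\<close>.
\<close>

definition is_invariant_set :: "nat \<Rightarrow> (nat \<Rightarrow> complex \<Rightarrow> complex) \<Rightarrow> complex set \<Rightarrow> bool" where
  "is_invariant_set n \<phi> K \<longleftrightarrow> K \<noteq> {} \<and> compact K \<and> K = (\<Union>i\<in>{1..n}. \<phi> i ` K)"

end

theory Submission
  imports Defs
begin

text \<open>
  Let \<open>K\<close> be the invariant set, and say that a point of \<open>K\<close> supports \<open>K\<close> in the direction \<open>u\<close> if it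
  maximises the inner product with \<open>u\<close> over \<open>K\<close>. If \<open>z\<close> supports \<open>K\<close> in the direction \<open>u\<close> and
  \<open>z = \<phi>\<^sub>i z'\<close> with \<open>z' \<in> K\<close>, then \<open>z'\<close> supports \<open>K\<close> in the direction obtained from \<open>u\<close> by undoing the
  rotation of \<open>\<phi>\<^sub>i\<close>. Iterating, one reads off an address of \<open>z\<close> together with a sequence of
  directions.

  As all angles are commensurable with \<open>\<pi>\<close>, all rotations are \<open>N\<close>-th roots of unity for a common
  \<open>N\<close>. So at most \<open>N\<close> directions can occur, and two of the first \<open>N + 1\<close> coincide: there are words
  \<open>v\<close> and \<open>w\<close> of length at most \<open>N\<close>, with \<open>w\<close> not empty, such that \<open>w\<close> leads from the direction
  reached after \<open>v\<close> back to that same direction. The composition along \<open>w\<close> then acts on the heights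
  in this direction as a contraction of the real line that fixes the maximal height, so its fixed
  point in the plane has maximal height as well (\<open>support_fixed_point\<close>). Hence the image under \<open>v\<close>
  of the fixed point of \<open>w\<close> also supports \<open>K\<close> in the direction \<open>u\<close>.

  There are only finitely many pairs \<open>(v, w)\<close>, independently of \<open>u\<close>. So finitely many points of
  \<open>K\<close> support \<open>K\<close> in all directions (\<open>exists_periodic_support\<close>), and by separation of convex sets
  their convex hull is that of \<open>K\<close>.
\<close>

section \<open>Support points of a set\<close>

definition supports :: "'a::real_inner set \<Rightarrow> 'a \<Rightarrow> 'a \<Rightarrow> bool" where
  "supports K u z \<longleftrightarrow> z \<in> K \<and> (\<forall>y\<in>K. u \<bullet> y \<le> u \<bullet> z)"

lemma exists_support:
  assumes "compact K" "K \<noteq> {}"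
  shows "\<exists>z. supports K u z"
proof -
  have "continuous_on K (\<lambda>y. u \<bullet> y)"
    by (intro continuous_intros)
  from continuous_attains_sup[OF assms this] show ?thesis
    by (auto simp: supports_def)
qed

text \<open>
  A point of \<open>K\<close> outside the closed convex set \<open>convex hull F\<close> could be separated from it, and the
  direction of separation would have no support point in \<open>F\<close>.
\<close>

lemma convex_hull_eq_of_supports:
  fixes K F :: "'a::euclidean_space set"
  assumes "finite F" "F \<subseteq> K" and sup: "\<And>u. \<exists>x\<in>F. supports K u x"
  shows "convex hull K = convex hull F"
proof (rule antisym)
  show "convex hull F \<subseteq> convex hull K"
    by (rule hull_mono) fact
  have "K \<subseteq> convex hull F"
  proof
    fix y assume "y \<in> K"
    show "y \<in> convex hull F"
    proof (rule ccontr)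
      assume "y \<notin> convex hull F"
      moreover have "closed (convex hull F)"
        using \<open>finite F\<close> by (intro compact_imp_closed finite_imp_compact_convex_hull)
      ultimately obtain a b where ab: "a \<bullet> y < b" "\<And>x. x \<in> convex hull F \<Longrightarrow> a \<bullet> x > b"
        using separating_hyperplane_closed_point[of "convex hull F" y] by (auto simp: convex_convex_hull)
      obtain x where "x \<in> F" "supports K (- a) x"
        using sup by blast
      then have "a \<bullet> x \<le> a \<bullet> y"
        using \<open>y \<in> K\<close> by (auto simp: supports_def)
      moreover have "b < a \<bullet> x"
        using ab(2) \<open>x \<in> F\<close> by (simp add: hull_inc)
      ultimately show False
        using ab(1) by simp
    qed
  qed
  then show "convex hull K \<subseteq> convex hull F"
    by (simp add: hull_minimal)
qed

section \<open>Orientation-preserving similarities of the plane\<close>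

text \<open>
  The ratio \<open>r\<close> and the rotation \<open>g\<close> are separate parameters because the ratio scales heights
  while the rotation changes the direction in which heights are measured.
\<close>

definition similarity_with :: "real \<Rightarrow> complex \<Rightarrow> (complex \<Rightarrow> complex) \<Rightarrow> bool" where
  "similarity_with r g f \<longleftrightarrow> (\<forall>y z. f y - f z = complex_of_real r * g * (y - z))"

lemma similarity_with_id: "similarity_with 1 1 id"
  by (simp add: similarity_with_def)

lemma similarity_with_comp:
  assumes "similarity_with r g f" "similarity_with s h k"
  shows "similarity_with (r * s) (g * h) (f \<circ> k)"
  using assms by (simp add: similarity_with_def mult_ac)

lemma similarity_with_similitude: "similarity_with q (cis a) (similitude q a c)"
  by (simp add: similarity_with_def similitude_def cis_conv_exp algebra_simps)

lemma inner_complex_mult_right: "u \<bullet> (g * z) = (cnj g * u) \<bullet> z" for u g z :: complex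
  by (simp add: inner_complex_def algebra_simps)

lemma similarity_with_height_diff:
  assumes "similarity_with r g f"
  shows "u \<bullet> f y - u \<bullet> f z = r * ((cnj g * u) \<bullet> y - (cnj g * u) \<bullet> z)"
proof -
  have "u \<bullet> f y - u \<bullet> f z = u \<bullet> (f y - f z)"
    by (simp add: inner_diff_right)
  also have "\<dots> = u \<bullet> (r *\<^sub>R (g * (y - z)))"
    using assms by (simp add: similarity_with_def scaleR_conv_of_real mult.assoc)
  also have "\<dots> = r * ((cnj g * u) \<bullet> (y - z))"
    by (simp add: inner_complex_mult_right)
  finally show ?thesis
    by (simp add: inner_diff_right)
qed

lemma similarity_with_fixed_point:
  assumes f: "similarity_with r g f" and "norm g = 1" "0 < r" "r < 1"
    and K: "compact K" "K \<noteq> {}" "f ` K \<subseteq> K"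
  shows "\<exists>x\<in>K. f x = x"
proof -
  have "dist (f y) (f z) \<le> r * dist y z" for y z
    using assms by (simp add: dist_norm similarity_with_def norm_mult)
  then have "\<exists>!x\<in>K. f x = x"
    using K \<open>0 < r\<close> \<open>r < 1\<close> by (intro Banach_fix) (auto simp: compact_imp_complete)
  then show ?thesis
    by blast
qed

text \<open>
  The point \<open>z\<close> is the highest of \<open>K\<close> in the rotated direction because \<open>f z\<close> is already the highest
  point of the larger set \<open>K \<supseteq> f ` K\<close>, and \<open>f\<close> preserves the order of heights.
\<close>

lemma supports_pull_back:
  assumes f: "similarity_with r g f" "0 < r" "f ` K \<subseteq> K"
    and z: "supports K u (f z)" "z \<in> K"
  shows "supports K (cnj g * u) z"
  unfolding supports_def
proof (intro conjI ballI)
  fix y assume "y \<in> K"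
  then have "u \<bullet> f y \<le> u \<bullet> f z"
    using f z by (auto simp: supports_def)
  then have "r * ((cnj g * u) \<bullet> y - (cnj g * u) \<bullet> z) \<le> 0"
    using similarity_with_height_diff[OF f(1), of u y z] by simp
  then show "(cnj g * u) \<bullet> y \<le> (cnj g * u) \<bullet> z"
    using \<open>0 < r\<close> by (simp add: mult_le_0_iff)
qed fact

lemma supports_push_forward:
  assumes f: "similarity_with r g f" "0 < r" "f ` K \<subseteq> K"
    and z: "supports K u (f z)" "z \<in> K" and x: "supports K (cnj g * u) x"
  shows "supports K u (f x)"
proof -
  have "(cnj g * u) \<bullet> z \<le> (cnj g * u) \<bullet> x"
    using x z by (simp add: supports_def)
  then have "0 \<le> r * ((cnj g * u) \<bullet> x - (cnj g * u) \<bullet> z)"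
    using \<open>0 < r\<close> by simp
  then have "u \<bullet> f z \<le> u \<bullet> f x"
    using similarity_with_height_diff[OF f(1), of u x z] by simp
  then show ?thesis
    using z x f(3) by (force simp: supports_def)
qed

text \<open>
  If the map preserves the direction \<open>u\<close>, the heights \<open>s\<close> of \<open>z\<close> and \<open>t\<close> of the fixed point satisfy
  \<open>u \<bullet> f z - t = r * (s - t)\<close>, and both \<open>u \<bullet> f z\<close> and \<open>s\<close> are the maximal height; as \<open>r \<noteq> 1\<close>,
  this forces \<open>s = t\<close>.
\<close>

lemma support_fixed_point:
  assumes f: "similarity_with r g f" "0 < r" "r < 1" "f ` K \<subseteq> K"
    and u: "cnj g * u = u" and z: "supports K u (f z)" "z \<in> K"
    and x: "x \<in> K" "f x = x"
  shows "supports K u x"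
proof -
  have "supports K u z"
    using supports_pull_back[OF f(1,2,4) z] u by simp
  then have "u \<bullet> f z = u \<bullet> z"
    using z \<open>supports K u z\<close> by (auto simp: supports_def intro!: antisym)
  then have "(1 - r) * (u \<bullet> z - u \<bullet> x) = 0"
    using similarity_with_height_diff[OF f(1), of u z x] x
    unfolding u by (simp add: algebra_simps)
  then have "u \<bullet> z = u \<bullet> x"
    using \<open>r < 1\<close> by simp
  then show ?thesis
    using \<open>supports K u z\<close> x by (simp add: supports_def)
qed

section \<open>Self-similar sets with finitely many rotations\<close>

locale finite_rotation_system =
  fixes I :: "'i set" and f :: "'i \<Rightarrow> complex \<Rightarrow> complex"
    and r :: "'i \<Rightarrow> real" and g :: "'i \<Rightarrow> complex" and N :: nat and K :: "complex set"
  assumes finite_I: "finite I"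
    and ratio_pos: "i \<in> I \<Longrightarrow> 0 < r i" and ratio_less: "i \<in> I \<Longrightarrow> r i < 1"
    and similarity: "i \<in> I \<Longrightarrow> similarity_with (r i) (g i) (f i)"
    and N_pos: "0 < N" and root: "i \<in> I \<Longrightarrow> g i ^ N = 1"
    and K_compact: "compact K" and K_nonempty: "K \<noteq> {}"
    and K_invariant: "K = (\<Union>i\<in>I. f i ` K)"
begin

definition word_map :: "'i list \<Rightarrow> complex \<Rightarrow> complex" where
  "word_map w = foldr (\<circ>) (map f w) id"

definition word_ratio :: "'i list \<Rightarrow> real" where
  "word_ratio w = prod_list (map r w)"

definition word_rotation :: "'i list \<Rightarrow> complex" where
  "word_rotation w = prod_list (map g w)"

lemma word_similarity:
  "set w \<subseteq> I \<Longrightarrow> similarity_with (word_ratio w) (word_rotation w) (word_map w)"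
  by (induction w)
    (auto simp: word_map_def word_ratio_def word_rotation_def similarity_with_id
      intro: similarity_with_comp similarity)

lemma word_ratio_pos: "set w \<subseteq> I \<Longrightarrow> 0 < word_ratio w"
  by (induction w) (auto simp: word_ratio_def ratio_pos)

lemma word_ratio_le: "set w \<subseteq> I \<Longrightarrow> word_ratio w \<le> 1"
proof (induction w)
  case (Cons i w)
  then show ?case
    using mult_mono[of "r i" 1 "word_ratio w" 1] ratio_less[of i] word_ratio_pos[of w]
    by (simp add: word_ratio_def)
qed (simp add: word_ratio_def)

lemma word_ratio_less: "set w \<subseteq> I \<Longrightarrow> w \<noteq> [] \<Longrightarrow> word_ratio w < 1"
proof (cases w)
  case (Cons i v)
  moreover assume "set w \<subseteq> I"
  ultimately have "i \<in> I" "set v \<subseteq> I" by auto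
  then have "r i * word_ratio v \<le> r i * 1"
    by (intro mult_left_mono word_ratio_le) (auto intro: less_imp_le ratio_pos)
  then show ?thesis
    using ratio_less[OF \<open>i \<in> I\<close>] Cons by (simp add: word_ratio_def)
qed simp

lemma word_rotation_root: "set w \<subseteq> I \<Longrightarrow> word_rotation w ^ N = 1"
  by (induction w) (auto simp: word_rotation_def power_mult_distrib root)

lemma norm_word_rotation: "set w \<subseteq> I \<Longrightarrow> norm (word_rotation w) = 1"
  using word_rotation_root[of w] N_pos power_eq_1_iff by blast

lemma word_map_invariant: "set w \<subseteq> I \<Longrightarrow> word_map w ` K \<subseteq> K"
proof (induction w)
  case (Cons i w)
  then have "f i ` word_map w ` K \<subseteq> f i ` K" "i \<in> I"
    by auto
  then show ?case
    using K_invariant by (fastforce simp: word_map_def)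
qed (simp add: word_map_def)

definition periodic_point :: "'i list \<Rightarrow> complex" where
  "periodic_point w = (SOME x. x \<in> K \<and> word_map w x = x)"

lemma periodic_point:
  assumes "set w \<subseteq> I" "w \<noteq> []"
  shows "periodic_point w \<in> K" "word_map w (periodic_point w) = periodic_point w"
proof -
  have "\<exists>x\<in>K. word_map w x = x"
    using assms K_compact K_nonempty
    by (intro similarity_with_fixed_point[OF word_similarity])
      (auto simp: norm_word_rotation word_ratio_pos word_ratio_less dest: word_map_invariant)
  then have "periodic_point w \<in> K \<and> word_map w (periodic_point w) = periodic_point w"
    unfolding periodic_point_def Bex_def by (rule someI_ex)
  then show "periodic_point w \<in> K" "word_map w (periodic_point w) = periodic_point w"
    by auto
qed

definition short_words :: "'i list set" where
  "short_words = {w. set w \<subseteq> I \<and> length w \<le> N}"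

text \<open>
  The points whose address has the form \<open>v w w w \<dots>\<close> with \<open>v\<close> and \<open>w\<close> of length at most \<open>N\<close>.
\<close>

definition short_periodic_points :: "complex set" where
  "short_periodic_points =
     (\<lambda>(v, w). word_map v (periodic_point w)) ` (short_words \<times> (short_words - {[]}))"

lemma finite_short_periodic_points: "finite short_periodic_points"
  unfolding short_periodic_points_def short_words_def
  by (intro finite_imageI finite_cartesian_product finite_Diff finite_lists_length_le finite_I)

lemma short_periodic_points_subset: "short_periodic_points \<subseteq> K"
  using word_map_invariant periodic_point(1)
  by (fastforce simp: short_periodic_points_def short_words_def)

text \<open>
  Reading off the address of a support point, letter by letter, together with the directions in
  which its successive preimages support \<open>K\<close>.
\<close>

lemma exists_support_itinerary:
  assumes "supports K u z"
  shows "\<exists>d p. d 0 = u \<and> p 0 = z \<and> (\<forall>k. supports K (d k) (p k)) \<and>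
    (\<forall>k. \<exists>i\<in>I. d (Suc k) = cnj (g i) * d k \<and> p k = f i (p (Suc k)))"
proof -
  \<comment> \<open>Dependent choice leaves the first element open; the last conjunct of \<open>P\<close> pins it down.\<close>
  define P where "P = (\<lambda>(k::nat) (x::complex \<times> complex).
    supports K (fst x) (snd x) \<and> (k = 0 \<longrightarrow> x = (u, z)))"
  define Q where "Q = (\<lambda>(k::nat) (x::complex \<times> complex) (x'::complex \<times> complex).
    \<exists>i\<in>I. fst x' = cnj (g i) * fst x \<and> snd x = f i (snd x'))"
  have base: "\<exists>x. P 0 x"
    using assms by (auto simp: P_def)
  have step: "\<exists>x'. P (Suc k) x' \<and> Q k x x'" if "P k x" for k x
  proof -
    have sup: "supports K (fst x) (snd x)"
      using that by (simp add: P_def)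
    then have "snd x \<in> (\<Union>i\<in>I. f i ` K)"
      using K_invariant by (simp add: supports_def)
    then obtain i y where i: "i \<in> I" "y \<in> K" "snd x = f i y"
      by auto
    have "f i ` K \<subseteq> K"
      using i(1) K_invariant by blast
    with i sup have "supports K (cnj (g i) * fst x) y"
      by (intro supports_pull_back[OF similarity ratio_pos]) auto
    then show ?thesis
      using i by (intro exI[of _ "(cnj (g i) * fst x, y)"]) (auto simp: P_def Q_def)
  qed
  obtain s where "\<And>k. P k (s k)" "\<And>k. Q k (s k) (s (Suc k))"
    using dependent_nat_choice[of P Q, OF base step] by blast
  then show ?thesis
    by (intro exI[of _ "fst \<circ> s"] exI[of _ "snd \<circ> s"]) (auto simp: P_def Q_def)
qed

lemma itinerary_word:
  assumes "\<And>k. \<exists>i\<in>I. d (Suc k) = cnj (g i) * d k \<and> p k = f i (p (Suc k))"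
  shows "\<exists>w. set w \<subseteq> I \<and> length w = m \<and> d (k + m) = cnj (word_rotation w) * d k \<and>
    p k = word_map w (p (k + m))"
proof (induction m arbitrary: k)
  case 0
  show ?case
    by (simp add: word_rotation_def word_map_def)
next
  case (Suc m)
  obtain i where i: "i \<in> I" "d (Suc k) = cnj (g i) * d k" "p k = f i (p (Suc k))"
    using assms by blast
  obtain w where w: "set w \<subseteq> I" "length w = m" "d (Suc k + m) = cnj (word_rotation w) * d (Suc k)"
    "p (Suc k) = word_map w (p (Suc k + m))"
    using Suc.IH by blast
  show ?case
    using i w by (intro exI[of _ "i # w"]) (simp add: word_rotation_def word_map_def)
qed

text \<open>
  The directions of an itinerary lie in the orbit of \<open>u\<close> under the group of \<open>N\<close>-th roots of unity,
  which has at most \<open>N\<close> elements.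
\<close>

lemma itinerary_direction_repeats:
  assumes "\<And>k. \<exists>i\<in>I. d (Suc k) = cnj (g i) * d k \<and> p k = f i (p (Suc k))"
  shows "\<exists>k l. k < l \<and> l \<le> N \<and> d k = d l"
proof -
  let ?roots = "{x::complex. x ^ N = 1}"
  have "d m \<in> (\<lambda>x. x * d 0) ` ?roots" for m
  proof -
    obtain w where w: "set w \<subseteq> I" "d m = cnj (word_rotation w) * d 0"
      using itinerary_word[of d p, OF assms, of m 0] by auto
    have "cnj (word_rotation w) ^ N = 1"
      using word_rotation_root[OF w(1)] by (metis complex_cnj_one complex_cnj_power)
    then show ?thesis
      using w(2) by blast
  qed
  then have sub: "d ` {..N} \<subseteq> (\<lambda>x. x * d 0) ` ?roots"
    by blast
  have fin: "finite ?roots"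
    using N_pos by (intro finite_roots_unity) auto
  have "card (d ` {..N}) \<le> card ((\<lambda>x. x * d 0) ` ?roots)"
    using sub fin by (intro card_mono) auto
  also have "\<dots> \<le> card ?roots"
    by (rule card_image_le[OF fin])
  also have "\<dots> \<le> N"
    using N_pos by (intro card_roots_unity) auto
  finally have "card (d ` {..N}) < card {..N}"
    by simp
  then have "\<not> inj_on d {..N}"
    by (rule pigeonhole)
  then obtain k l where "k \<le> N" "l \<le> N" "k \<noteq> l" "d k = d l"
    by (auto simp: inj_on_def)
  then show ?thesis
    by (metis linorder_neqE_nat)
qed

lemma exists_periodic_support: "\<exists>x\<in>short_periodic_points. supports K u x"
proof -
  obtain z where "supports K u z"
    using exists_support[OF K_compact K_nonempty] by blast
  then obtain d p where start: "d 0 = u" and sup: "\<And>k. supports K (d k) (p k)"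
    and step: "\<And>k. \<exists>i\<in>I. d (Suc k) = cnj (g i) * d k \<and> p k = f i (p (Suc k))"
    using exists_support_itinerary by metis
  have p_in: "p k \<in> K" for k
    using sup by (simp add: supports_def)
  obtain k l where kl: "k < l" "l \<le> N" "d k = d l"
    using itinerary_direction_repeats[of d p, OF step] by blast
  obtain v where v: "set v \<subseteq> I" "length v = k" "d k = cnj (word_rotation v) * u"
    "p 0 = word_map v (p k)"
    using itinerary_word[of d p, OF step, of k 0] start by auto
  obtain w where w: "set w \<subseteq> I" "length w = l - k" "d l = cnj (word_rotation w) * d k"
    "p k = word_map w (p l)"
    using itinerary_word[of d p, OF step, of "l - k" k] kl(1) by auto
  have "w \<noteq> []"
    using w(2) kl(1) by auto
  let ?x = "periodic_point w"
  have x: "?x \<in> K" "word_map w ?x = ?x"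
    using periodic_point[OF w(1) \<open>w \<noteq> []\<close>] by auto
  have "cnj (word_rotation w) * d k = d k"
    using w(3) kl(3) by metis
  moreover have "supports K (d k) (word_map w (p l))"
    using sup[of k] unfolding w(4) .
  ultimately have "supports K (d k) ?x"
    using p_in x
    by (rule support_fixed_point[OF word_similarity[OF w(1)] word_ratio_pos[OF w(1)]
          word_ratio_less[OF w(1) \<open>w \<noteq> []\<close>] word_map_invariant[OF w(1)]])
  then have "supports K (cnj (word_rotation v) * u) ?x"
    unfolding v(3) .
  moreover have "supports K u (word_map v (p k))"
    using sup[of 0] unfolding start v(4) .
  ultimately have "supports K u (word_map v ?x)"
    using p_in
    by (blast intro: supports_push_forward[OF word_similarity[OF v(1)] word_ratio_pos[OF v(1)]
          word_map_invariant[OF v(1)]])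
  moreover have "word_map v ?x \<in> short_periodic_points"
    using v(1,2) w(1,2) kl(1,2) \<open>w \<noteq> []\<close>
    by (auto simp: short_periodic_points_def short_words_def intro!: image_eqI[of _ _ "(v, w)"])
  ultimately show ?thesis
    by blast
qed

lemma convex_hull_eq_short_periodic_points: "convex hull K = convex hull short_periodic_points"
  by (intro convex_hull_eq_of_supports finite_short_periodic_points
      short_periodic_points_subset exists_periodic_support)

end

section \<open>Angles commensurable with \<open>\<pi>\<close>\<close>

lemma commensurable_imp_root_of_unity:
  assumes "commensurable_with_pi a"
  shows "\<exists>m>0. cis a ^ m = 1"
proof -
  obtain x y :: int where "y > 0" "a / pi = of_int x / of_int y"
    using assms unfolding commensurable_with_pi_def by (metis Rats_cases')
  then have "real (2 * nat y) * a = of_int x * (2 * pi)"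
    by (simp add: field_simps)
  then have "cis a ^ (2 * nat y) = cis (of_int x * (2 * pi))"
    by (simp only: Complex.DeMoivre)
  also have "\<dots> = 1"
    by (metis Ints_of_int cis_multiple_2pi mult.commute)
  finally show ?thesis
    using \<open>y > 0\<close> by (intro exI[of _ "2 * nat y"]) auto
qed

lemma common_root_exponent:
  fixes g :: "'i \<Rightarrow> 'a::monoid_mult"
  assumes "finite I" "\<And>i. i \<in> I \<Longrightarrow> \<exists>m>0. g i ^ m = 1"
  shows "\<exists>N>0. \<forall>i\<in>I. g i ^ N = 1"
proof -
  obtain m :: "'i \<Rightarrow> nat" where m: "\<And>i. i \<in> I \<Longrightarrow> m i > 0 \<and> g i ^ m i = 1"
    using assms(2) by metis
  have "g i ^ prod m I = 1" if "i \<in> I" for i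
  proof -
    obtain k where "prod m I = m i * k"
      using dvd_prodI[of I i m] assms(1) \<open>i \<in> I\<close> by (auto elim: dvdE)
    then show ?thesis
      using m[OF that] by (simp add: power_mult)
  qed
  moreover have "prod m I > 0"
    using m by (intro prod_pos) auto
  ultimately show ?thesis
    by blast
qed

theorem corollary15:
  fixes n :: nat
    and q \<alpha> :: "nat \<Rightarrow> real"
    and c :: "nat \<Rightarrow> complex"
    and \<phi> :: "nat \<Rightarrow> complex \<Rightarrow> complex"
    and K :: "complex set"
  assumes "\<And>i. i \<in> {1..n} \<Longrightarrow> 0 < q i \<and> q i < 1"
    and "\<And>i. i \<in> {1..n} \<Longrightarrow> 0 \<le> \<alpha> i \<and> \<alpha> i \<le> 2 * pi"
    and "\<And>i. i \<in> {1..n} \<Longrightarrow> \<phi> i = similitude (q i) (\<alpha> i) (c i)"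
    and "open_convex_set_condition n \<phi>"
    and "\<And>i. i \<in> {1..n} \<Longrightarrow> commensurable_with_pi (\<alpha> i)"
    and "is_invariant_set n \<phi> K"
  shows "polytope (convex hull K) \<and> finite {x. x extreme_point_of (convex hull K)}"
proof -
  obtain N where N: "N > 0" "\<forall>i\<in>{1..n}. cis (\<alpha> i) ^ N = 1"
    using common_root_exponent[of "{1..n}" "\<lambda>i. cis (\<alpha> i)"]
      commensurable_imp_root_of_unity[OF assms(5)] by auto
  have K: "compact K" "K \<noteq> {}" "K = (\<Union>i\<in>{1..n}. \<phi> i ` K)"
    using assms(6) by (auto simp: is_invariant_set_def)
  interpret finite_rotation_system "{1..n}" \<phi> q "\<lambda>i. cis (\<alpha> i)" N K
    by unfold_locales (use assms(1) N K in \<open>auto simp: assms(3) similarity_with_similitude\<close>)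
  have hull: "convex hull K = convex hull short_periodic_points"
    by (rule convex_hull_eq_short_periodic_points)
  have "{x. x extreme_point_of (convex hull K)} \<subseteq> short_periodic_points"
    unfolding hull by (rule extreme_points_of_convex_hull)
  then show ?thesis
    using finite_short_periodic_points finite_subset hull unfolding polytope_def by blast
qed

end
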